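(* Let $(C,\bar\xi)$ be a versor field in a Myller configuration with Frenet-type frame $R_F=\{P(s);\bar\xi_1,\bar\xi_2,\bar\xi_3\}$ and (nowhere) non-zero curvatures $K_1,K_2$. Then $\bar\xi_3$ satisfies the differential equation $$\bar\xi_3'''-\left[\frac{(K_1K_2)'}{K_1K_2}+\frac{K_2'}{K_2}\right]\bar\xi_3''+\left\{K_1K_2\left[\frac1{K_1}\left(\frac1{K_2}\right)'\right]'+K_1^2+K_2^2\right\}\bar\xi_3'+K_1K_2\left(\frac{K_2}{K_1}\right)'\bar\xi_3=0.$$
   Context: All data are smooth. Let $C$ be a curve in Euclidean space $E^3$ with arclength parameter $s\in I$ ($I$ an interval) and position vector $\bar r(s)$, let $\bar\xi(s)$ be a unit vector field along $C$ (a versor field $(C,\bar\xi)$), and let $\pi(s)$ be a plane field along $C$ with $\bar\xi(s)\in\pi(s)$. The pair $((C,\bar\xi),(C,\pi))$ is called a Myller configuration $M=M(C,\bar\xi,\pi)$. Put $\bar\xi_1=\bar\xi$, $K_1=\|d\bar\xi/ds\|>0$ (curvature), define $\bar\xi_2$ by $\bar\xi_1'=K_1\bar\xi_2$, and $\bar\xi_3=\bar\xi_1\times\bar\xi_2$. Then $R_F=\{P(s);\bar\xi_1,\bar\xi_2,\bar\xi_3\}$ is a positively oriented orthonormal frame, the Frenet-type frame, and $$\bar\xi_1'=K_1\bar\xi_2,\quad \bar\xi_2'=-K_1\bar\xi_1+K_2\bar\xi_3,\quad \bar\xi_3'=-K_2\bar\xi_2,$$ which defines the torsion $K_2$. A prime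 denotes $d/ds$. *)

theory Defs
  imports "HOL-Analysis.Analysis"
begin

text \<open>
  Differentiation along a nondegenerate interval \<open>I\<close>, one-sided at endpoints belonging to \<open>I\<close>.
  Higher derivatives are iterates \<open>(D_on I ^^ n) f\<close>; values outside \<open>I\<close> play no role.
\<close>

definition D_on :: "real set \<Rightarrow> (real \<Rightarrow> 'a::real_normed_vector) \<Rightarrow> real \<Rightarrow> 'a"
  where "D_on I f = (\<lambda>s. vector_derivative f (at s within I))"

definition smooth_along :: "real set \<Rightarrow> (real \<Rightarrow> 'a::real_normed_vector) \<Rightarrow> bool"
  where "smooth_along I f \<longleftrightarrow> (\<forall>n. \<forall>s\<in>I. (D_on I ^^ n) f differentiable (at s within I))"

definition arclength_curve :: "real set \<Rightarrow> (real \<Rightarrow> real^3) \<Rightarrow> bool"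
  where "arclength_curve I r \<longleftrightarrow> smooth_along I r \<and> (\<forall>s\<in>I. norm (D_on I r s) = 1)"

definition versor_field :: "real set \<Rightarrow> (real \<Rightarrow> real^3) \<Rightarrow> bool"
  where "versor_field I \<xi> \<longleftrightarrow> smooth_along I \<xi> \<and> (\<forall>s\<in>I. norm (\<xi> s) = 1)"

text \<open>
  A plane at the point \<open>r s\<close> is represented by its direction space, a two-dimensional linear
  subspace; smoothness means local existence of smooth spanning pairs.
\<close>

definition plane_field :: "real set \<Rightarrow> (real \<Rightarrow> (real^3) set) \<Rightarrow> bool"
  where "plane_field I \<pi> \<longleftrightarrow>
    (\<forall>s\<in>I. subspace (\<pi> s) \<and> dim (\<pi> s) = 2) \<and>
    (\<forall>s\<in>I. \<exists>e>0. \<exists>u v. smooth_along (I \<inter> ball s e) u \<and> smooth_along (I \<inter> ball s e) v \<and>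
        (\<forall>t \<in> I \<inter> ball s e. \<pi> t = span {u t, v t}))"

definition myller_configuration ::
    "real set \<Rightarrow> (real \<Rightarrow> real^3) \<Rightarrow> (real \<Rightarrow> real^3) \<Rightarrow> (real \<Rightarrow> (real^3) set) \<Rightarrow> bool"
  where "myller_configuration I r \<xi> \<pi> \<longleftrightarrow>
    is_interval I \<and> interior I \<noteq> {} \<and>
    arclength_curve I r \<and> versor_field I \<xi> \<and> plane_field I \<pi> \<and> (\<forall>s\<in>I. \<xi> s \<in> \<pi> s)"

definition curvature1 :: "real set \<Rightarrow> (real \<Rightarrow> real^3) \<Rightarrow> real \<Rightarrow> real"
  where "curvature1 I \<xi> s = norm (D_on I \<xi> s)"

definition frame2 :: "real set \<Rightarrow> (real \<Rightarrow> real^3) \<Rightarrow> real \<Rightarrow> real^3"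
  where "frame2 I \<xi> s = D_on I \<xi> s /\<^sub>R curvature1 I \<xi> s"

definition frame3 :: "real set \<Rightarrow> (real \<Rightarrow> real^3) \<Rightarrow> real \<Rightarrow> real^3"
  where "frame3 I \<xi> s = cross3 (\<xi> s) (frame2 I \<xi> s)"

text \<open>
  The torsion is determined by the second Frenet-type equation, since \<open>frame3 I \<xi> s\<close> is a unit
  vector wherever \<open>curvature1\<close> does not vanish.
\<close>

definition curvature2 :: "real set \<Rightarrow> (real \<Rightarrow> real^3) \<Rightarrow> real \<Rightarrow> real"
  where "curvature2 I \<xi> s =
    (THE k. D_on I (frame2 I \<xi>) s = - curvature1 I \<xi> s *\<^sub>R \<xi> s + k *\<^sub>R frame3 I \<xi> s)"

end

theory Submission
  imports Defs
begin

text \<open>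
  The frame \<open>\<xi>\<^sub>1, \<xi>\<^sub>2, \<xi>\<^sub>3\<close> satisfies a linear system of Frenet type, so every derivative of
  \<open>\<xi>\<^sub>3\<close> is a combination of the frame with coefficients built from \<open>K\<^sub>1\<close>, \<open>K\<^sub>2\<close> and their
  derivatives:
  \<open>\<xi>\<^sub>3' = - K\<^sub>2 \<xi>\<^sub>2\<close>,
  \<open>\<xi>\<^sub>3'' = K\<^sub>1 K\<^sub>2 \<xi>\<^sub>1 - K\<^sub>2' \<xi>\<^sub>2 - K\<^sub>2\<^sup>2 \<xi>\<^sub>3\<close>, and
  \<open>\<xi>\<^sub>3''' = ((K\<^sub>1 K\<^sub>2)' + K\<^sub>1 K\<^sub>2') \<xi>\<^sub>1 + (K\<^sub>1\<^sup>2 K\<^sub>2 + K\<^sub>2\<^sup>3 - K\<^sub>2'') \<xi>\<^sub>2 - 3 K\<^sub>2 K\<^sub>2' \<xi>\<^sub>3\<close>.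
  Four vectors in three-space are dependent. In the claimed relation the coefficient of \<open>\<xi>\<^sub>3''\<close> is
  the one that cancels \<open>\<xi>\<^sub>1\<close>, those of \<open>\<xi>\<^sub>3'\<close> and \<open>\<xi>\<^sub>3\<close> then cancel \<open>\<xi>\<^sub>2\<close> and \<open>\<xi>\<^sub>3\<close>.

  The analytic content is that \<open>K\<^sub>1\<close> and \<open>K\<^sub>2\<close> are smooth, although one is defined by a norm and
  the other by a description. This follows from closure of smooth functions under bilinear
  products, reciprocals and square roots, since \<open>K\<^sub>1 = sqrt (\<xi>' \<bullet> \<xi>')\<close> with a positive radicand
  and \<open>K\<^sub>2 = \<xi>\<^sub>2' \<bullet> \<xi>\<^sub>3\<close>. The lemma \<open>frenet_frame_versor_field\<close> collects this together with
  the Frenet system, and \<open>third_order_equation\<close> carries out the elimination.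
\<close>

section \<open>Derivatives along a set without isolated points\<close>

lemma D_on_cong:
  assumes "\<And>t. t \<in> I \<Longrightarrow> f t = g t" "s \<in> I"
  shows "D_on I f s = D_on I g s"
  unfolding D_on_def by (rule vector_derivative_cong_eq) (use assms in auto)

lemma differentiable_within_cong:
  assumes "\<And>t. t \<in> I \<Longrightarrow> f t = g t" "s \<in> I"
  shows "f differentiable (at s within I) \<longleftrightarrow> g differentiable (at s within I)"
  using differentiable_transform_within[of f s I 1 g] differentiable_transform_within[of g s I 1 f]
    assms by auto

text \<open>
  Smoothness is treated through finite orders of differentiability, because the derivative of a
  product is a sum of two products: the closure properties become inductions on the order.
\<close>

primrec times_differentiable_on :: "nat \<Rightarrow> real set \<Rightarrow> (real \<Rightarrow> 'a::real_normed_vector) \<Rightarrow> bool"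
  where
    "times_differentiable_on 0 I f \<longleftrightarrow> True"
  | "times_differentiable_on (Suc n) I f \<longleftrightarrow>
      (\<forall>s\<in>I. f differentiable (at s within I)) \<and> times_differentiable_on n I (D_on I f)"

lemma times_differentiable_on_iff:
  "times_differentiable_on n I f \<longleftrightarrow>
    (\<forall>k<n. \<forall>s\<in>I. (D_on I ^^ k) f differentiable (at s within I))"
proof (induction n arbitrary: f)
  case (Suc n)
  then show ?case
    unfolding times_differentiable_on.simps All_less_Suc2 by (simp add: funpow_swap1)
qed simp

lemma smooth_along_iff_times_differentiable_on:
  "smooth_along I f \<longleftrightarrow> (\<forall>n. times_differentiable_on n I f)"
  unfolding smooth_along_def times_differentiable_on_iff by blast

lemma times_differentiable_on_Suc_imp:
  "times_differentiable_on (Suc n) I f \<Longrightarrow> times_differentiable_on n I f"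
  by (simp add: times_differentiable_on_iff)

lemma times_differentiable_on_cong:
  assumes "\<And>t. t \<in> I \<Longrightarrow> f t = g t"
  shows "times_differentiable_on n I f \<longleftrightarrow> times_differentiable_on n I g"
  using assms
proof (induction n arbitrary: f g)
  case (Suc n)
  have "times_differentiable_on n I (D_on I f) \<longleftrightarrow> times_differentiable_on n I (D_on I g)"
    using Suc.prems by (intro Suc.IH D_on_cong) auto
  with Suc.prems differentiable_within_cong[of I f g] show ?case by auto
qed simp

lemma smooth_along_cong:
  "(\<And>t. t \<in> I \<Longrightarrow> f t = g t) \<Longrightarrow> smooth_along I f \<longleftrightarrow> smooth_along I g"
  unfolding smooth_along_iff_times_differentiable_on using times_differentiable_on_cong by blast

lemma smooth_along_D_on: "smooth_along I f \<Longrightarrow> smooth_along I (D_on I f)"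
  by (metis smooth_along_iff_times_differentiable_on times_differentiable_on.simps(2))

lemma has_vector_derivative_D_on:
  "smooth_along I f \<Longrightarrow> s \<in> I \<Longrightarrow> (f has_vector_derivative D_on I f s) (at s within I)"
  unfolding smooth_along_def D_on_def
  by (drule spec[of _ 0]) (auto simp: vector_derivative_works)

text \<open>
  At an isolated point every vector is a derivative, so \<open>D_on\<close> would be an arbitrary choice
  there. Excluding such points makes derivatives unique, which turns the differentiation rules
  into equations for \<open>D_on\<close>.
\<close>

locale perfect_domain =
  fixes I :: "real set"
  assumes at_within_nontrivial: "s \<in> I \<Longrightarrow> at s within I \<noteq> bot"
begin

lemma D_on_eqI:
  "(f has_vector_derivative d) (at s within I) \<Longrightarrow> s \<in> I \<Longrightarrow> D_on I f s = d"
  unfolding D_on_def by (rule vector_derivative_within[OF at_within_nontrivial])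

lemma times_differentiable_on_SucI:
  assumes "\<And>s. s \<in> I \<Longrightarrow> (f has_vector_derivative g s) (at s within I)"
    and "times_differentiable_on n I g"
  shows "times_differentiable_on (Suc n) I f"
proof -
  have "times_differentiable_on n I (D_on I f)"
    using times_differentiable_on_cong[of I "D_on I f" g n] D_on_eqI[OF assms(1)] assms(2) by auto
  then show ?thesis
    using assms(1) differentiableI_vector by auto
qed

lemma times_differentiable_on_SucE:
  assumes "times_differentiable_on (Suc n) I f" "s \<in> I"
  shows "(f has_vector_derivative D_on I f s) (at s within I)"
  using assms by (simp add: D_on_def flip: vector_derivative_works)

lemma times_differentiable_on_add:
  assumes "times_differentiable_on n I f" "times_differentiable_on n I g"
  shows "times_differentiable_on n I (\<lambda>t. f t + g t)"
  using assms
proof (induction n arbitrary: f g)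
  case (Suc n)
  show ?case
    by (rule times_differentiable_on_SucI[where g = "\<lambda>t. D_on I f t + D_on I g t"])
      (use Suc in \<open>auto intro!: has_vector_derivative_add times_differentiable_on_SucE\<close>)
qed simp

lemma times_differentiable_on_bilinear:
  assumes "bounded_bilinear h" "times_differentiable_on n I f" "times_differentiable_on n I g"
  shows "times_differentiable_on n I (\<lambda>t. h (f t) (g t))"
  using assms(2,3)
proof (induction n arbitrary: f g)
  case (Suc n)
  show ?case
  proof (rule times_differentiable_on_SucI)
    show "((\<lambda>t. h (f t) (g t)) has_vector_derivative
        h (f s) (D_on I g s) + h (D_on I f s) (g s)) (at s within I)" if "s \<in> I" for s
      by (intro bounded_bilinear.has_vector_derivative[OF assms(1)]
          Suc.prems[THEN times_differentiable_on_SucE, OF that])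
    show "times_differentiable_on n I (\<lambda>s. h (f s) (D_on I g s) + h (D_on I f s) (g s))"
      using Suc.prems Suc.prems[THEN times_differentiable_on_Suc_imp]
      by (auto intro!: times_differentiable_on_add Suc.IH)
  qed
qed simp

text \<open>
  The closure under reciprocals and square roots rests on the derivative being algebraic in the function itself:
  \<open>(1/f)' = - f' (1/f)\<^sup>2\<close> and \<open>(sqrt f)' = f' / (2 sqrt f)\<close>. If \<open>f\<close> is \<open>n + 1\<close> times
  differentiable, then \<open>f'\<close> and, by induction, \<open>1/f\<close> or \<open>sqrt f\<close> are \<open>n\<close> times
  differentiable, hence so is the right-hand side.
\<close>

lemma times_differentiable_on_inverse:
  fixes f :: "real \<Rightarrow> real"
  assumes "times_differentiable_on n I f" "\<And>t. t \<in> I \<Longrightarrow> f t \<noteq> 0"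
  shows "times_differentiable_on n I (\<lambda>t. inverse (f t))"
  using assms(1)
proof (induction n)
  case (Suc n)
  let ?g = "\<lambda>t. inverse (f t)"
  have g: "times_differentiable_on n I ?g"
    using Suc times_differentiable_on_Suc_imp by blast
  have neg: "times_differentiable_on n I (\<lambda>t. -1 * D_on I f t)"
  proof (rule times_differentiable_on_bilinear[OF bounded_bilinear_mult])
    have "times_differentiable_on m I (\<lambda>t. c)" for m and c :: real
    proof (induction m arbitrary: c)
      case (Suc m)
      show ?case
        by (rule times_differentiable_on_SucI[where g = "\<lambda>_. 0"]) (auto intro: Suc.IH)
    qed simp
    then show "times_differentiable_on n I (\<lambda>t. -1 :: real)" .
    show "times_differentiable_on n I (D_on I f)" using Suc.prems by simp
  qed
  show ?case
  proof (rule times_differentiable_on_SucI)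
    show "(?g has_vector_derivative (-1 * D_on I f s) * (?g s * ?g s)) (at s within I)"
      if "s \<in> I" for s
      using times_differentiable_on_SucE[OF Suc.prems that] assms(2)[OF that]
      unfolding has_real_derivative_iff_has_vector_derivative[symmetric]
      by (auto intro!: derivative_eq_intros)
    show "times_differentiable_on n I (\<lambda>s. (-1 * D_on I f s) * (?g s * ?g s))"
      by (intro times_differentiable_on_bilinear[OF bounded_bilinear_mult] neg g)
  qed
qed simp

lemma times_differentiable_on_sqrt:
  fixes f :: "real \<Rightarrow> real"
  assumes "times_differentiable_on n I f" "\<And>t. t \<in> I \<Longrightarrow> f t > 0"
  shows "times_differentiable_on n I (\<lambda>t. sqrt (f t))"
  using assms(1)
proof (induction n)
  case (Suc n)
  let ?g = "\<lambda>t. sqrt (f t)"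
  have g: "times_differentiable_on n I ?g"
    using Suc times_differentiable_on_Suc_imp by blast
  show ?case
  proof (rule times_differentiable_on_SucI)
    show "(?g has_vector_derivative D_on I f s * inverse (?g s + ?g s)) (at s within I)"
      if "s \<in> I" for s
      using times_differentiable_on_SucE[OF Suc.prems that] assms(2)[OF that]
      unfolding has_real_derivative_iff_has_vector_derivative[symmetric]
      by (auto intro!: derivative_eq_intros simp: field_simps)
    have "?g t + ?g t \<noteq> 0" if "t \<in> I" for t using assms(2)[OF that] by simp
    then show "times_differentiable_on n I (\<lambda>s. D_on I f s * inverse (?g s + ?g s))"
      using Suc.prems
      by (intro times_differentiable_on_bilinear[OF bounded_bilinear_mult]
          times_differentiable_on_inverse times_differentiable_on_add g) auto
  qed
qed simp

lemma smooth_along_bilinear: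
  "bounded_bilinear h \<Longrightarrow> smooth_along I f \<Longrightarrow> smooth_along I g \<Longrightarrow>
    smooth_along I (\<lambda>t. h (f t) (g t))"
  by (simp add: smooth_along_iff_times_differentiable_on times_differentiable_on_bilinear)

lemma smooth_along_inverse:
  fixes f :: "real \<Rightarrow> real"
  shows "smooth_along I f \<Longrightarrow> (\<And>t. t \<in> I \<Longrightarrow> f t \<noteq> 0) \<Longrightarrow> smooth_along I (\<lambda>t. inverse (f t))"
  by (simp add: smooth_along_iff_times_differentiable_on times_differentiable_on_inverse)

lemma smooth_along_norm:
  fixes f :: "real \<Rightarrow> 'a::real_inner"
  assumes "smooth_along I f" "\<And>t. t \<in> I \<Longrightarrow> f t \<noteq> 0"
  shows "smooth_along I (\<lambda>t. norm (f t))"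
proof -
  have "smooth_along I (\<lambda>t. f t \<bullet> f t)"
    by (rule smooth_along_bilinear[OF bounded_bilinear_inner assms(1) assms(1)])
  then show ?thesis
    unfolding norm_eq_sqrt_inner smooth_along_iff_times_differentiable_on
    using assms(2) by (auto intro!: times_differentiable_on_sqrt)
qed

lemma D_on_inner_const:
  fixes f g :: "real \<Rightarrow> 'a::real_inner"
  assumes "smooth_along I f" "smooth_along I g" "\<And>t. t \<in> I \<Longrightarrow> f t \<bullet> g t = c" "s \<in> I"
  shows "f s \<bullet> D_on I g s + D_on I f s \<bullet> g s = 0"
proof -
  have "D_on I (\<lambda>t. f t \<bullet> g t) s = f s \<bullet> D_on I g s + D_on I f s \<bullet> g s"
    by (intro D_on_eqI bounded_bilinear.has_vector_derivative[OF bounded_bilinear_inner]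
        has_vector_derivative_D_on assms)
  moreover have "D_on I (\<lambda>t. f t \<bullet> g t) s = D_on I (\<lambda>t. c) s"
    using assms by (intro D_on_cong) auto
  moreover have "D_on I (\<lambda>t. c) s = 0"
    using \<open>s \<in> I\<close> by (intro D_on_eqI) auto
  ultimately show ?thesis by simp
qed

end

lemma perfect_domain_interval:
  assumes "is_interval I" "interior I \<noteq> {}"
  shows "perfect_domain I"
proof
  fix s assume "s \<in> I"
  have "\<not> (\<exists>a. I = {a})" using assms(2) by auto
  then have "s islimpt I"
    using \<open>s \<in> I\<close> is_interval_connected[OF assms(1)] connected_imp_perfect by blast
  then show "at s within I \<noteq> bot" by (simp add: trivial_limit_within)
qed

section \<open>The Frenet-type equations\<close>

lemma orthonormal_cross3_expansion:
  assumes "norm a = 1" "norm b = 1" "a \<bullet> b = 0"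
  shows "v = (v \<bullet> a) *\<^sub>R a + (v \<bullet> b) *\<^sub>R b + (v \<bullet> cross3 a b) *\<^sub>R cross3 a b"
proof -
  let ?c = "cross3 a b"
  define w where "w = v - ((v \<bullet> a) *\<^sub>R a + (v \<bullet> b) *\<^sub>R b + (v \<bullet> ?c) *\<^sub>R ?c)"
  have c: "norm ?c = 1"
    using norm_cross_dot[of a b] assms by (simp add: power2_eq_1_iff) (smt (verit) norm_ge_zero)
  have dots: "a \<bullet> a = 1" "b \<bullet> b = 1" "?c \<bullet> ?c = 1" "b \<bullet> a = 0" "?c \<bullet> a = 0" "?c \<bullet> b = 0"
      "a \<bullet> ?c = 0" "b \<bullet> ?c = 0"
    using assms c by (simp_all add: norm_eq_1 inner_commute dot_cross_self)
  have w: "w \<bullet> a = 0" "w \<bullet> b = 0" "w \<bullet> ?c = 0"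
    using dots assms(3) by (simp_all add: w_def inner_diff_left inner_add_left)
  \<comment> \<open>Being orthogonal to \<open>a\<close> and \<open>b\<close>, \<open>w\<close> is parallel to their cross product, to which it is
      also orthogonal.\<close>
  have "cross3 w ?c = 0" using w by (simp add: Lagrange)
  then have "norm w = 0" using norm_cross_dot[of w ?c] w c by simp
  then show ?thesis by (simp add: w_def)
qed

text \<open>
  The differential equation is a formal consequence of a Frenet system with smooth coefficients;
  the frame vectors enter only as placeholders for the three components.
\<close>

locale frenet_frame = perfect_domain I for I +
  fixes e1 e2 e3 :: "real \<Rightarrow> 'a::real_normed_vector" and K1 K2 :: "real \<Rightarrow> real"
  assumes e1': "s \<in> I \<Longrightarrow> (e1 has_vector_derivative K1 s *\<^sub>R e2 s) (at s within I)"
    and e2': "s \<in> I \<Longrightarrow>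
      (e2 has_vector_derivative - K1 s *\<^sub>R e1 s + K2 s *\<^sub>R e3 s) (at s within I)"
    and e3': "s \<in> I \<Longrightarrow> (e3 has_vector_derivative - K2 s *\<^sub>R e2 s) (at s within I)"
    and smooth: "smooth_along I K1" "smooth_along I K2"

text \<open>
  Differentiating \<open>\<xi> \<bullet> \<xi> = 1\<close>, \<open>\<xi>\<^sub>2 \<bullet> \<xi>\<^sub>2 = 1\<close> and \<open>\<xi> \<bullet> \<xi>\<^sub>2 = 0\<close> determines the components of
  \<open>\<xi>\<^sub>2'\<close> along \<open>\<xi>\<close> and \<open>\<xi>\<^sub>2\<close>; the remaining one is the torsion. The third equation follows by
  differentiating the cross product.
\<close>

lemma frenet_frame_versor_field:
  assumes I: "perfect_domain I" and versor: "versor_field I \<xi>"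
    and pos: "\<And>s. s \<in> I \<Longrightarrow> curvature1 I \<xi> s > 0"
  shows "frenet_frame I \<xi> (frame2 I \<xi>) (frame3 I \<xi>) (curvature1 I \<xi>) (curvature2 I \<xi>)"
proof -
  interpret perfect_domain I by (rule I)
  let ?K1 = "curvature1 I \<xi>" and ?K2 = "curvature2 I \<xi>"
  let ?e2 = "frame2 I \<xi>" and ?e3 = "frame3 I \<xi>"
  have \<xi>: "smooth_along I \<xi>" and unit: "\<And>s. s \<in> I \<Longrightarrow> norm (\<xi> s) = 1"
    using versor by (auto simp: versor_field_def)
  have K1: "smooth_along I ?K1"
    unfolding curvature1_def[abs_def]
    using pos by (intro smooth_along_norm smooth_along_D_on \<xi>) (force simp: curvature1_def)
  have e2: "smooth_along I ?e2"
    unfolding frame2_def[abs_def] using pos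
    by (intro smooth_along_bilinear[OF bounded_bilinear_scaleR] smooth_along_inverse
        smooth_along_D_on K1 \<xi>) force
  have cross: "bounded_bilinear cross3"
    by (simp add: bilinear_conv_bounded_bilinear[symmetric] bilinear_cross)
  have e3: "smooth_along I ?e3"
    unfolding frame3_def[abs_def] by (intro smooth_along_bilinear[OF cross] \<xi> e2)
  have D\<xi>: "D_on I \<xi> s = ?K1 s *\<^sub>R ?e2 s" if "s \<in> I" for s
    using pos[OF that] by (simp add: frame2_def)
  have unit2: "norm (?e2 s) = 1" if "s \<in> I" for s
    using pos[OF that] by (simp add: frame2_def curvature1_def)
  have orth: "\<xi> s \<bullet> ?e2 s = 0" if "s \<in> I" for s
    using D_on_inner_const[OF \<xi> \<xi>, of 1 s] that unit pos[OF that]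
    by (simp add: norm_eq_1 D\<xi> inner_commute)
  have unit3: "?e3 s \<bullet> ?e3 s = 1" if "s \<in> I" for s
    using norm_cross_dot[of "\<xi> s" "?e2 s"] unit[OF that] unit2[OF that] orth[OF that]
    by (simp add: frame3_def power2_norm_eq_inner)
  have De2: "D_on I ?e2 s = - ?K1 s *\<^sub>R \<xi> s + (D_on I ?e2 s \<bullet> ?e3 s) *\<^sub>R ?e3 s" if "s \<in> I" for s
  proof -
    have "D_on I ?e2 s \<bullet> \<xi> s = - ?K1 s"
      using D_on_inner_const[OF \<xi> e2, of 0 s] that orth unit2[OF that]
      by (simp add: D\<xi> norm_eq_1 inner_commute)
    moreover have "D_on I ?e2 s \<bullet> ?e2 s = 0"
      using D_on_inner_const[OF e2 e2, of 1 s] that unit2 by (simp add: norm_eq_1 inner_commute)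
    ultimately show ?thesis
      using orthonormal_cross3_expansion[OF unit[OF that] unit2[OF that] orth[OF that],
          of "D_on I ?e2 s"]
      by (simp add: frame3_def)
  qed
  have K2_eq: "?K2 s = D_on I ?e2 s \<bullet> ?e3 s" if "s \<in> I" for s
    unfolding curvature2_def
  proof (rule the_equality)
    show "D_on I ?e2 s = - ?K1 s *\<^sub>R \<xi> s + (D_on I ?e2 s \<bullet> ?e3 s) *\<^sub>R ?e3 s"
      by (rule De2[OF that])
    fix k assume k: "D_on I ?e2 s = - ?K1 s *\<^sub>R \<xi> s + k *\<^sub>R ?e3 s"
    have "\<xi> s \<bullet> ?e3 s = 0" by (simp add: frame3_def dot_cross_self)
    then show "k = D_on I ?e2 s \<bullet> ?e3 s"
      using unit3[OF that] by (subst k) (simp add: inner_diff_left)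
  qed
  have K2: "smooth_along I ?K2"
    using smooth_along_cong[of I ?K2 "\<lambda>s. D_on I ?e2 s \<bullet> ?e3 s"] K2_eq
      smooth_along_bilinear[OF bounded_bilinear_inner smooth_along_D_on[OF e2] e3] by blast
  have De3: "D_on I ?e3 s = - ?K2 s *\<^sub>R ?e2 s" if "s \<in> I" for s
  proof -
    have "D_on I ?e3 s = cross3 (\<xi> s) (D_on I ?e2 s) + cross3 (D_on I \<xi> s) (?e2 s)"
      unfolding frame3_def[abs_def]
      by (intro D_on_eqI[OF _ that] bounded_bilinear.has_vector_derivative[OF cross]
          has_vector_derivative_D_on[OF _ that] \<xi> e2)
    also have "\<dots> = ?K2 s *\<^sub>R cross3 (\<xi> s) (?e3 s)"
      unfolding D\<xi>[OF that]
      by (subst De2[OF that])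
        (simp add: K2_eq[OF that] Cross3.right_diff_distrib cross_mult_left cross_mult_right)
    also have "cross3 (\<xi> s) (?e3 s) = - ?e2 s"
      using unit[OF that] orth[OF that] by (simp add: frame3_def Lagrange norm_eq_1)
    finally show ?thesis by simp
  qed
  show ?thesis
  proof
    fix s assume s: "s \<in> I"
    show "(\<xi> has_vector_derivative ?K1 s *\<^sub>R ?e2 s) (at s within I)"
      using has_vector_derivative_D_on[OF \<xi> s] by (simp add: D\<xi>[OF s])
    show "(?e2 has_vector_derivative - ?K1 s *\<^sub>R \<xi> s + ?K2 s *\<^sub>R ?e3 s) (at s within I)"
      using has_vector_derivative_D_on[OF e2 s] De2[OF s] by (simp add: K2_eq[OF s])
    show "(?e3 has_vector_derivative - ?K2 s *\<^sub>R ?e2 s) (at s within I)"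
      using has_vector_derivative_D_on[OF e3 s] by (simp add: De3[OF s])
  qed (rule K1 K2)+
qed

section \<open>The differential equation of the third frame vector\<close>

context frenet_frame
begin

abbreviation "K1' \<equiv> D_on I K1"
abbreviation "K2' \<equiv> D_on I K2"
abbreviation "K2'' \<equiv> D_on I K2'"

lemma curvature_derivatives:
  assumes "s \<in> I"
  shows "(K1 has_real_derivative K1' s) (at s within I)"
    and "(K2 has_real_derivative K2' s) (at s within I)"
    and "(K2' has_real_derivative K2'' s) (at s within I)"
  using smooth smooth_along_D_on[OF smooth(2)] assms
  by (simp_all add: has_real_derivative_iff_has_vector_derivative has_vector_derivative_D_on)

lemma D_on_real_eqI:
  "(f has_real_derivative d) (at s within I) \<Longrightarrow> s \<in> I \<Longrightarrow> D_on I f s = d"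
  by (simp add: D_on_eqI has_real_derivative_iff_has_vector_derivative)

lemma D1_e3: "s \<in> I \<Longrightarrow> D_on I e3 s = - K2 s *\<^sub>R e2 s"
  by (intro D_on_eqI e3')

lemma D2_e3:
  assumes "s \<in> I"
  shows "D_on I (D_on I e3) s =
    (K1 s * K2 s) *\<^sub>R e1 s - K2' s *\<^sub>R e2 s - (K2 s)\<^sup>2 *\<^sub>R e3 s"
proof -
  have "D_on I (\<lambda>t. - K2 t *\<^sub>R e2 t) s =
      - K2 s *\<^sub>R (- K1 s *\<^sub>R e1 s + K2 s *\<^sub>R e3 s) + (- K2' s) *\<^sub>R e2 s"
    using assms curvature_derivatives
    by (intro D_on_eqI has_vector_derivative_scaleR DERIV_minus e2') auto
  also have "\<dots> = (K1 s * K2 s) *\<^sub>R e1 s - K2' s *\<^sub>R e2 s - (K2 s)\<^sup>2 *\<^sub>R e3 s"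
    by (simp add: algebra_simps power2_eq_square)
  finally show ?thesis
    using D_on_cong[of I "D_on I e3" "\<lambda>t. - K2 t *\<^sub>R e2 t" s] D1_e3 assms by simp
qed

lemma D3_e3:
  assumes "s \<in> I"
  shows "D_on I (D_on I (D_on I e3)) s =
    (K1' s * K2 s + 2 * (K1 s * K2' s)) *\<^sub>R e1 s
    + ((K1 s)\<^sup>2 * K2 s + K2 s ^ 3 - K2'' s) *\<^sub>R e2 s
    - (3 * K2 s * K2' s) *\<^sub>R e3 s"
proof -
  have "D_on I (\<lambda>t. (K1 t * K2 t) *\<^sub>R e1 t - K2' t *\<^sub>R e2 t - (K2 t)\<^sup>2 *\<^sub>R e3 t) s =
      ((K1 s * K2 s) *\<^sub>R (K1 s *\<^sub>R e2 s) + (K1' s * K2 s + K2' s * K1 s) *\<^sub>R e1 s)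
      - (K2' s *\<^sub>R (- K1 s *\<^sub>R e1 s + K2 s *\<^sub>R e3 s) + K2'' s *\<^sub>R e2 s)
      - ((K2 s)\<^sup>2 *\<^sub>R (- K2 s *\<^sub>R e2 s) + (2 * K2 s * K2' s) *\<^sub>R e3 s)"
    using assms curvature_derivatives
    by (intro D_on_eqI has_vector_derivative_diff has_vector_derivative_scaleR e1' e2' e3')
      (auto intro!: derivative_eq_intros)
  also have "\<dots> = (K1' s * K2 s + 2 * (K1 s * K2' s)) *\<^sub>R e1 s
      + ((K1 s)\<^sup>2 * K2 s + K2 s ^ 3 - K2'' s) *\<^sub>R e2 s - (3 * K2 s * K2' s) *\<^sub>R e3 s"
  proof -
    have "3 * K2 s * K2' s = K2 s * K2' s + K2 s * K2' s + K2 s * K2' s"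
      "2 * K2 s * K2' s = K2 s * K2' s + K2 s * K2' s"
      "2 * (K1 s * K2' s) = K1 s * K2' s + K1 s * K2' s" by simp_all
    then show ?thesis
      by (simp only: scaleR_add_left) (simp add: algebra_simps power2_eq_square power3_eq_cube)
  qed
  finally show ?thesis
    using D_on_cong[of I "D_on I (D_on I e3)", OF D2_e3 assms] by simp
qed

theorem third_order_equation:
  assumes s: "s \<in> I" and K1: "\<And>t. t \<in> I \<Longrightarrow> K1 t \<noteq> 0" and K2: "\<And>t. t \<in> I \<Longrightarrow> K2 t \<noteq> 0"
  shows "(D_on I ^^ 3) e3 s
    - (D_on I (\<lambda>t. K1 t * K2 t) s / (K1 s * K2 s) + K2' s / K2 s) *\<^sub>R (D_on I ^^ 2) e3 s
    + (K1 s * K2 s * D_on I (\<lambda>t. (1 / K1 t) * D_on I (\<lambda>u. 1 / K2 u) t) s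
        + (K1 s)\<^sup>2 + (K2 s)\<^sup>2) *\<^sub>R D_on I e3 s
    + (K1 s * K2 s * D_on I (\<lambda>t. K2 t / K1 t) s) *\<^sub>R e3 s = 0"
proof -
  note d = curvature_derivatives[OF s] and nz = K1[OF s] K2[OF s]
  have prod: "D_on I (\<lambda>t. K1 t * K2 t) s = K1' s * K2 s + K1 s * K2' s"
    using d by (intro D_on_real_eqI s) (auto intro!: derivative_eq_intros)
  have quot: "D_on I (\<lambda>t. K2 t / K1 t) s = (K2' s * K1 s - K2 s * K1' s) / (K1 s * K1 s)"
    using d nz by (intro D_on_real_eqI s DERIV_divide)
  have recip: "D_on I (\<lambda>u. 1 / K2 u) t = - K2' t / (K2 t)\<^sup>2" if "t \<in> I" for t
    using curvature_derivatives[OF that] K2[OF that]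
    by (intro D_on_real_eqI that) (auto intro!: derivative_eq_intros simp: power2_eq_square)
  have "D_on I (\<lambda>t. (1 / K1 t) * D_on I (\<lambda>u. 1 / K2 u) t) s
      = D_on I (\<lambda>t. - K2' t / (K1 t * (K2 t)\<^sup>2)) s"
    using s by (intro D_on_cong) (auto simp: recip)
  also have "\<dots> = (- K2'' s * (K1 s * (K2 s)\<^sup>2)
      - (- K2' s) * (K1' s * (K2 s)\<^sup>2 + 2 * K2 s * K2' s * K1 s))
      / (K1 s * (K2 s)\<^sup>2 * (K1 s * (K2 s)\<^sup>2))"
    using d nz by (intro D_on_real_eqI s DERIV_divide) (auto intro!: derivative_eq_intros)
  finally have nested: "D_on I (\<lambda>t. (1 / K1 t) * D_on I (\<lambda>u. 1 / K2 u) t) s = \<dots>" .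
  define a where "a = D_on I (\<lambda>t. K1 t * K2 t) s / (K1 s * K2 s) + K2' s / K2 s"
  define b where "b = K1 s * K2 s * D_on I (\<lambda>t. (1 / K1 t) * D_on I (\<lambda>u. 1 / K2 u) t) s
    + (K1 s)\<^sup>2 + (K2 s)\<^sup>2"
  define c where "c = K1 s * K2 s * D_on I (\<lambda>t. K2 t / K1 t) s"
  have a: "a = K1' s / K1 s + 2 * K2' s / K2 s"
    unfolding a_def prod using nz by (simp add: field_simps)
  have b: "b = K1' s * K2' s / (K1 s * K2 s) - K2'' s / K2 s + 2 * (K2' s)\<^sup>2 / (K2 s)\<^sup>2
    + (K1 s)\<^sup>2 + (K2 s)\<^sup>2"
    unfolding b_def nested using nz
    by (simp add: divide_simps) (simp add: algebra_simps power2_eq_square power4_eq_xxxx)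
  have c: "c = K2 s * K2' s - (K2 s)\<^sup>2 * K1' s / K1 s"
    unfolding c_def quot using nz by (simp add: field_simps power2_eq_square)
  \<comment> \<open>These are the coefficients of \<open>e1\<close>, \<open>e2\<close> and \<open>e3\<close> in the claimed combination of
      derivatives.\<close>
  have coeffs:
    "K1' s * K2 s + 2 * (K1 s * K2' s) - a * (K1 s * K2 s) = 0"
    "(K1 s)\<^sup>2 * K2 s + K2 s ^ 3 - K2'' s + a * K2' s - b * K2 s = 0"
    "- (3 * K2 s * K2' s) + a * (K2 s)\<^sup>2 + c = 0"
    unfolding a b c using nz
    by (simp_all add: divide_simps)
      (simp_all add: algebra_simps power2_eq_square power3_eq_cube)
  have "(D_on I ^^ 3) e3 s - a *\<^sub>R (D_on I ^^ 2) e3 s + b *\<^sub>R D_on I e3 s + c *\<^sub>R e3 s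
    = (K1' s * K2 s + 2 * (K1 s * K2' s) - a * (K1 s * K2 s)) *\<^sub>R e1 s
    + ((K1 s)\<^sup>2 * K2 s + K2 s ^ 3 - K2'' s + a * K2' s - b * K2 s) *\<^sub>R e2 s
    + (- (3 * K2 s * K2' s) + a * (K2 s)\<^sup>2 + c) *\<^sub>R e3 s"
    unfolding numeral_2_eq_2 numeral_3_eq_3 funpow.simps o_apply id_apply
      D1_e3[OF s] D2_e3[OF s] D3_e3[OF s]
    by (simp add: scaleR_add_left scaleR_diff_left scaleR_diff_right)
  then show ?thesis
    unfolding coeffs by (simp add: a_def b_def c_def)
qed

end

theorem theorem23:
  fixes I :: "real set" and r \<xi> \<xi>3 :: "real \<Rightarrow> real^3" and \<pi> :: "real \<Rightarrow> (real^3) set"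
    and K1 K2 :: "real \<Rightarrow> real"
  assumes "myller_configuration I r \<xi> \<pi>"
    and "K1 = curvature1 I \<xi>" and "K2 = curvature2 I \<xi>" and "\<xi>3 = frame3 I \<xi>"
    and "\<forall>s\<in>I. K1 s > 0" and "\<forall>s\<in>I. K2 s \<noteq> 0"
  shows "\<forall>s\<in>I.
    (D_on I ^^ 3) \<xi>3 s
    - (D_on I (\<lambda>t. K1 t * K2 t) s / (K1 s * K2 s) + D_on I K2 s / K2 s) *\<^sub>R (D_on I ^^ 2) \<xi>3 s
    + (K1 s * K2 s * D_on I (\<lambda>t. (1 / K1 t) * D_on I (\<lambda>u. 1 / K2 u) t) s
        + (K1 s)\<^sup>2 + (K2 s)\<^sup>2) *\<^sub>R D_on I \<xi>3 s
    + (K1 s * K2 s * D_on I (\<lambda>t. K2 t / K1 t) s) *\<^sub>R \<xi>3 s = 0"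
proof -
  have "perfect_domain I"
    using assms(1) by (intro perfect_domain_interval) (auto simp: myller_configuration_def)
  moreover have "versor_field I \<xi>" using assms(1) by (simp add: myller_configuration_def)
  ultimately have "frenet_frame I \<xi> (frame2 I \<xi>) \<xi>3 K1 K2"
    using frenet_frame_versor_field assms(2-5) by simp
  then interpret frenet_frame I \<xi> "frame2 I \<xi>" \<xi>3 K1 K2 .
  show ?thesis
    using assms(5,6) by (intro ballI third_order_equation) auto
qed

end
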